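(* Let $k\ge 1$ and $n\ge m\ge 1$ be integers such that either $k=1$, or $k\ge 2$ and $$(n+1)\cdot\left\lceil\frac{n+1}{k-1}\right\rceil> m\big((k-1)n+m\big).$$ (a) If $k$ is odd, then $r(S(n,m);k)=kn+m+2$. (b) If $k$ is even, then $\max\{kn+1,\ (k-1)n+2m+2\}\le r(S(n,m);k)\le kn+m+2$.
   Context: All graphs are finite, simple and undirected. For integers $n\ge m\ge 1$, the double star $S(n,m)$ is the graph consisting of the disjoint union of two stars $K_{1,n}$ and $K_{1,m}$ together with an edge joining their centers. A $k$-edge-coloring of a graph $G$ is any function $\tau:E(G)\to\{1,\dots,k\}$ (not necessarily proper). For a graph $H$ and integer $k\ge1$, the $k$-color Ramsey number $r(H;k)$ is the smallest integer $N$ such that every $k$-edge-coloring of the complete graph $K_N$ contains a monochromatic copy of $H$ (as a not necessarily induced subgraph). *)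

theory Defs
  imports Complex_Main "HOL-Library.Ramsey"
begin

text \<open>
  A graph is a pair of a finite vertex set and a set of two-element subsets of it, so
  it is simple and undirected by construction.
\<close>

type_synonym 'a graph = "'a set \<times> 'a set set"

abbreviation verts :: "'a graph \<Rightarrow> 'a set" where "verts \<equiv> fst"
abbreviation edges :: "'a graph \<Rightarrow> 'a set set" where "edges \<equiv> snd"

definition is_graph :: "'a graph \<Rightarrow> bool" where
  "is_graph G \<longleftrightarrow> finite (verts G) \<and> edges G \<subseteq> [verts G]\<^bsup>2\<^esup>"

definition complete_graph :: "nat \<Rightarrow> nat graph" where
  "complete_graph N = ({..<N}, [{..<N}]\<^bsup>2\<^esup>)"

text \<open>The star \<open>K\<^sub>1\<^sub>,\<^sub>n\<close> has centre \<open>0\<close> and leaves \<open>1, \<dots>, n\<close>.\<close>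

definition star :: "nat \<Rightarrow> nat graph" where
  "star n = ({0..n}, {{0, i} |i. i \<in> {1..n}})"

definition disjoint_union :: "'a graph \<Rightarrow> 'b graph \<Rightarrow> ('a + 'b) graph" where
  "disjoint_union G H =
     (verts G <+> verts H, (\<lambda>e. Inl ` e) ` edges G \<union> (\<lambda>e. Inr ` e) ` edges H)"

definition double_star :: "nat \<Rightarrow> nat \<Rightarrow> (nat + nat) graph" where
  "double_star n m =
     (let U = disjoint_union (star n) (star m)
      in (verts U, insert {Inl 0, Inr 0} (edges U)))"

definition contains_copy :: "'a graph \<Rightarrow> 'b graph \<Rightarrow> bool" where
  "contains_copy G H \<longleftrightarrow>
     (\<exists>f. inj_on f (verts H) \<and> f ` verts H \<subseteq> verts G \<and> (\<forall>e \<in> edges H. f ` e \<in> edges G))"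

text \<open>Values of \<open>\<tau>\<close> outside \<open>edges G\<close> are irrelevant.\<close>

definition edge_coloring :: "nat \<Rightarrow> 'a graph \<Rightarrow> ('a set \<Rightarrow> nat) \<Rightarrow> bool" where
  "edge_coloring k G \<tau> \<longleftrightarrow> \<tau> \<in> edges G \<rightarrow> {1..k}"

definition color_class :: "'a graph \<Rightarrow> ('a set \<Rightarrow> nat) \<Rightarrow> nat \<Rightarrow> 'a graph" where
  "color_class G \<tau> c = (verts G, {e \<in> edges G. \<tau> e = c})"

definition has_monochromatic_copy ::
    "nat \<Rightarrow> 'a graph \<Rightarrow> ('a set \<Rightarrow> nat) \<Rightarrow> 'b graph \<Rightarrow> bool" where
  "has_monochromatic_copy k G \<tau> H \<longleftrightarrow> (\<exists>c \<in> {1..k}. contains_copy (color_class G \<tau> c) H)"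

definition arrows :: "nat \<Rightarrow> nat \<Rightarrow> 'a graph \<Rightarrow> bool" where
  "arrows N k H \<longleftrightarrow>
     (\<forall>\<tau>. edge_coloring k (complete_graph N) \<tau> \<longrightarrow>
          has_monochromatic_copy k (complete_graph N) \<tau> H)"

text \<open>
  For a finite graph \<open>H\<close> and \<open>k \<ge> 1\<close> the minimum exists by Ramsey's theorem; otherwise
  \<open>LEAST\<close> would return an unspecified number.
\<close>

definition ramsey_number :: "'a graph \<Rightarrow> nat \<Rightarrow> nat" where
  "ramsey_number H k = (LEAST N. arrows N k H)"

lemma is_graph_complete_graph: "is_graph (complete_graph N)"
  by (auto simp: is_graph_def complete_graph_def)

lemma is_graph_double_star: "is_graph (double_star n m)"
  by (auto simp: is_graph_def double_star_def disjoint_union_def star_def Let_def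
      nsets_def card_insert_if)

end

theory Submission
  imports Defs "HOL-Number_Theory.Cong"
begin

text \<open>
  The \<^emph>\<open>upper bound\<close>. Colour the complete graph on \<open>k n + m + 2\<close> vertices and suppose that no
  colour contains \<open>S(n,m)\<close>. Some vertex \<open>v\<close> has more than \<open>n\<close> neighbours in some colour \<open>i\<close>.
  Take a set \<open>S\<close> of exactly \<open>n + 1\<close> of them and let \<open>W\<close> be the set of the remaining
  \<open>(k - 1) n + m\<close> vertices. A vertex \<open>u\<close> of \<open>S\<close> with \<open>m\<close> neighbours of colour \<open>i\<close> in \<open>W\<close> would give
  \<open>S(n,m)\<close> with centres \<open>v\<close> and \<open>u\<close>, so at least \<open>(k - 1) n + 1\<close> edges from \<open>u\<close> to \<open>W\<close> have one of
  the other \<open>k - 1\<close> colours, and \<open>u\<close> has more than \<open>n\<close> neighbours in \<open>W\<close> in one colour \<open>j \<noteq> i\<close>. The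
  same \<open>j\<close> serves a set \<open>U\<close> of at least \<open>\<lceil>(n + 1) / (k - 1)\<rceil>\<close> vertices of \<open>S\<close>. There are at
  least \<open>(n + 1) |U|\<close> edges of colour \<open>j\<close> between \<open>U\<close> and \<open>W\<close>, more than \<open>m |W|\<close> by the numerical hypothesis,
  so some \<open>w \<in> W\<close> has more than \<open>m\<close> neighbours of colour \<open>j\<close> in \<open>U\<close>. Let \<open>u\<close> be one of them: \<open>u\<close> has
  \<open>n\<close> further neighbours in \<open>W\<close>, \<open>w\<close> has \<open>m\<close> further ones in \<open>U\<close>, and \<open>U\<close> and \<open>W\<close> are disjoint, so
  \<open>u\<close> and \<open>w\<close> are the centres of a monochromatic \<open>S(n,m)\<close> (lemma \<open>arrows_double_star\<close>).

  The \<^emph>\<open>lower bounds\<close>. A graph has no \<open>S(n,m)\<close> if some union \<open>X\<close> of components has at most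
  \<open>n + m + 1\<close> vertices and all degrees outside \<open>X\<close> are at most \<open>n\<close> (lemma
  \<open>no_double_star_if_small_closed_set\<close>). For odd \<open>k\<close>, take classes \<open>Q\<^sub>r\<close> of size \<open>n\<close> for the
  residues \<open>r\<close> modulo \<open>k\<close> and a set \<open>P\<close> of size \<open>m + 1\<close>. Give the colour \<open>r + s\<close> (modulo \<open>k\<close>) to the edges between
  \<open>Q\<^sub>r\<close> and \<open>Q\<^sub>s\<close>, and the colour \<open>2 r\<close> to the edges inside \<open>Q\<^sub>r\<close> and from \<open>Q\<^sub>r\<close> to \<open>P\<close>; those
  inside \<open>P\<close> may have any colour. As \<open>k\<close> is odd,
  each colour is \<open>2 r\<close> for a single \<open>r\<close>; it lives on the set \<open>Q\<^sub>r \<union> P\<close> of \<open>n + m + 1\<close> vertices and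
  on complete bipartite graphs between classes of size \<open>n\<close>. For even \<open>k\<close>, the classes \<open>Q\<^sub>r\<close> alone
  give \<open>k n\<close> vertices with all degrees at most \<open>n\<close>, and joining \<open>m\<close> new vertices in a new colour
  to the construction for \<open>k - 1\<close> colours gives \<open>(k - 1) n + 2 m + 1\<close> vertices.
\<close>

section \<open>Double stars as subgraphs\<close>

definition double_star_at ::
    "'a set set \<Rightarrow> nat \<Rightarrow> nat \<Rightarrow> 'a \<Rightarrow> 'a \<Rightarrow> 'a set \<Rightarrow> 'a set \<Rightarrow> bool" where
  "double_star_at E n m u v A B \<longleftrightarrow>
     {u, v} \<in> E \<and> (\<forall>a\<in>A. {u, a} \<in> E) \<and> (\<forall>b\<in>B. {v, b} \<in> E) \<and>
     finite A \<and> card A = n \<and> finite B \<and> card B = m \<and>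
     A \<inter> B = {} \<and> u \<notin> A \<union> B \<and> v \<notin> A \<union> B"

lemma is_graph_edgeD:
  assumes "is_graph G" and "{x, y} \<in> edges G"
  shows "x \<in> verts G" "y \<in> verts G" "x \<noteq> y"
  using assms subsetD[of "edges G" "[verts G]\<^bsup>2\<^esup>" "{x, y}"] by (simp_all add: is_graph_def)

lemma verts_double_star: "verts (double_star n m) = {0..n} <+> {0..m}"
  by (simp add: double_star_def disjoint_union_def star_def Let_def)

lemma edges_double_star:
  "edges (double_star n m) =
     insert {Inl 0, Inr 0} ({{Inl 0, Inl i} |i. i \<in> {1..n}} \<union> {{Inr 0, Inr i} |i. i \<in> {1..m}})"
  unfolding double_star_def disjoint_union_def star_def Let_def by (auto simp: image_iff) blast+

lemma double_star_at_imp_contains_copy: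
  assumes G: "is_graph G" and D: "double_star_at (edges G) n m u v A B"
  shows "contains_copy G (double_star n m)"
proof -
  note D = D[unfolded double_star_at_def]
  obtain g where g: "bij_betw g {1..n} A"
    using D finite_same_card_bij[of "{1..n}" A] by auto
  obtain h where h: "bij_betw h {1..m} B"
    using D finite_same_card_bij[of "{1..m}" B] by auto
  define f where "f = case_sum (\<lambda>i. if i = 0 then u else g i) (\<lambda>i. if i = 0 then v else h i)"
  have gA: "g i \<in> A" if "i \<in> {1..n}" for i
    using g that by (auto simp: bij_betw_def)
  have hB: "h i \<in> B" if "i \<in> {1..m}" for i
    using h that by (auto simp: bij_betw_def)
  have uv: "u \<noteq> v" "u \<in> verts G" "v \<in> verts G"
    using is_graph_edgeD[OF G, of u v] D by auto
  have AV: "A \<subseteq> verts G"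
    using is_graph_edgeD[OF G, of u] D by blast
  have BV: "B \<subseteq> verts G"
    using is_graph_edgeD[OF G, of v] D by blast
  have g0: "g i \<in> A" if "0 < i" "i \<le> n" for i using gA that by auto
  have h0: "h i \<in> B" if "0 < i" "i \<le> m" for i using hB that by auto
  have "inj_on f (verts (double_star n m))"
  proof (rule inj_onI)
    fix x y
    assume x: "x \<in> verts (double_star n m)" and y: "y \<in> verts (double_star n m)" and e: "f x = f y"
    have gi: "i = j" if "g i = g j" "0 < i" "i \<le> n" "0 < j" "j \<le> n" for i j
      using g that unfolding bij_betw_def inj_on_def by (metis Suc_leI One_nat_def atLeastAtMost_iff)
    have hi: "i = j" if "h i = h j" "0 < i" "i \<le> m" "0 < j" "j \<le> m" for i j
      using h that unfolding bij_betw_def inj_on_def by (metis Suc_leI One_nat_def atLeastAtMost_iff)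
    show "x = y"
    proof (cases x; cases y)
      fix i j assume "x = Inl i" "y = Inl j"
      then show ?thesis using x y e D g0[of i] g0[of j] gi[of i j]
        by (auto simp: f_def verts_double_star split: if_splits)
    next
      fix i j assume "x = Inl i" "y = Inr j"
      then show ?thesis using x y e D uv g0[of i] h0[of j]
        by (auto simp: f_def verts_double_star split: if_splits)
    next
      fix i j assume "x = Inr i" "y = Inl j"
      then show ?thesis using x y e D uv h0[of i] g0[of j]
        by (auto simp: f_def verts_double_star split: if_splits)
    next
      fix i j assume "x = Inr i" "y = Inr j"
      then show ?thesis using x y e D h0[of i] h0[of j] hi[of i j]
        by (auto simp: f_def verts_double_star split: if_splits)
    qed
  qed
  moreover have "f ` verts (double_star n m) \<subseteq> verts G"
    using uv subsetD[OF AV g0] subsetD[OF BV h0]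
    by (auto simp: f_def verts_double_star split: if_splits)
  moreover have "\<forall>e \<in> edges (double_star n m). f ` e \<in> edges G"
    using D gA hB by (auto simp: f_def edges_double_star)
  ultimately show ?thesis
    unfolding contains_copy_def by blast
qed

lemma contains_copy_imp_double_star_at:
  assumes "contains_copy G (double_star n m)"
  obtains u v A B where "double_star_at (edges G) n m u v A B"
proof -
  obtain f where f: "inj_on f ({0..n} <+> {0..m})"
    and e: "\<forall>e \<in> edges (double_star n m). f ` e \<in> edges G"
    using assms unfolding contains_copy_def verts_double_star by blast
  have e0: "{f (Inl 0), f (Inr 0)} \<in> edges G"
    using e[rule_format, of "{Inl 0, Inr 0}"] by (simp add: edges_double_star)
  have eA: "{f (Inl 0), f (Inl i)} \<in> edges G" if "i \<in> {1..n}" for i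
    using e[rule_format, of "{Inl 0, Inl i}"] that by (auto simp: edges_double_star)
  have eB: "{f (Inr 0), f (Inr i)} \<in> edges G" if "i \<in> {1..m}" for i
    using e[rule_format, of "{Inr 0, Inr i}"] that by (auto simp: edges_double_star)
  have cA: "card (f ` Inl ` {1..n}) = n"
    by (subst card_image, rule inj_on_subset[OF f]) (auto simp: card_image)
  have cB: "card (f ` Inr ` {1..m}) = m"
    by (subst card_image, rule inj_on_subset[OF f]) (auto simp: card_image)
  have "double_star_at (edges G) n m (f (Inl 0)) (f (Inr 0)) (f ` Inl ` {1..n}) (f ` Inr ` {1..m})"
    unfolding double_star_at_def using e0 eA eB cA cB by (auto dest!: inj_onD[OF f])
  then show thesis by (rule that)
qed

lemma is_graph_color_class: "is_graph G \<Longrightarrow> is_graph (color_class G \<tau> c)"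
  by (auto simp: is_graph_def color_class_def)

lemma edge_color_class_complete_graph:
  "{x, y} \<in> edges (color_class (complete_graph N) \<tau> c) \<longleftrightarrow>
     x < N \<and> y < N \<and> x \<noteq> y \<and> \<tau> {x, y} = c"
  by (auto simp: color_class_def complete_graph_def)

section \<open>Ramsey numbers\<close>

lemma arrows_mono:
  assumes "arrows N k H" and "N \<le> N'"
  shows "arrows N' k H"
  unfolding arrows_def
proof (intro allI impI)
  fix \<tau> assume "edge_coloring k (complete_graph N') \<tau>"
  moreover have sub: "[{..<N}]\<^bsup>2\<^esup> \<subseteq> [{..<N'}]\<^bsup>2\<^esup>"
    using assms(2) by (intro nsets_mono) auto
  ultimately have "edge_coloring k (complete_graph N) \<tau>"
    by (auto simp: edge_coloring_def complete_graph_def)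
  then obtain c f where c: "c \<in> {1..k}" "inj_on f (verts H)" "f ` verts H \<subseteq> {..<N}"
    "\<forall>e \<in> edges H. f ` e \<in> [{..<N}]\<^bsup>2\<^esup> \<and> \<tau> (f ` e) = c"
    using assms(1)
    by (auto simp: arrows_def has_monochromatic_copy_def contains_copy_def color_class_def
        complete_graph_def)
  moreover have "f ` verts H \<subseteq> {..<N'}"
    using c(3) assms(2) by auto
  ultimately have "contains_copy (color_class (complete_graph N') \<tau> c) H"
    using sub unfolding contains_copy_def color_class_def complete_graph_def fst_conv snd_conv
    by blast
  then show "has_monochromatic_copy k (complete_graph N') \<tau> H"
    using c(1) by (auto simp: has_monochromatic_copy_def)
qed

lemma ramsey_number_le: "arrows N k H \<Longrightarrow> ramsey_number H k \<le> N"
  unfolding ramsey_number_def by (rule Least_le)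

text \<open>
  Some complete graph has to arrow \<open>H\<close>, because otherwise the least such number has no meaning.
\<close>

lemma ramsey_number_gt:
  assumes "arrows M k H" and "\<not> arrows N k H"
  shows "N < ramsey_number H k"
proof (rule ccontr)
  assume "\<not> N < ramsey_number H k"
  moreover have "arrows (ramsey_number H k) k H"
    unfolding ramsey_number_def using assms(1) by (rule LeastI)
  ultimately show False
    using arrows_mono assms(2) by (meson not_less)
qed

section \<open>The upper bound\<close>

lemma pigeonhole_card_fibre:
  assumes "finite C" and "g ` S \<subseteq> C" and "card C * q < card S"
  obtains c where "c \<in> C" "q < card {s \<in> S. g s = c}"
proof -
  have "\<exists>c\<in>C. q < card {s \<in> S. g s = c}"
  proof (rule ccontr)
    assume *: "\<not> ?thesis"
    have "S = (\<Union>c\<in>C. {s \<in> S. g s = c})"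
      using assms(2) by auto
    then have "card S \<le> (\<Sum>c\<in>C. card {s \<in> S. g s = c})"
      using card_UN_le[OF assms(1), of "\<lambda>c. {s \<in> S. g s = c}"] by simp
    also have "\<dots> \<le> card C * q"
      using * sum_bounded_above[of C "\<lambda>c. card {s \<in> S. g s = c}" q] by (simp add: not_less)
    finally show False
      using assms(3) by simp
  qed
  then show thesis using that by blast
qed

text \<open>
  The two disjoint leaf sets come from the disjoint vertex sets \<open>S\<close> and \<open>W\<close>, so that only degrees
  into \<open>S\<close> and into \<open>W\<close> have to be counted, never common neighbours. The number \<open>q\<close> stands for \<open>\<lceil>(n + 1) / (k - 1)\<rceil> - 1\<close>. Any \<open>q\<close> below \<open>(n + 1) / (k - 1)\<close> can be
  used, and for \<open>k = 1\<close> this is no restriction, which makes a single colour an instance of the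
  general argument.
\<close>

lemma arrows_double_star:
  assumes k: "k \<ge> 1" and q: "(k - 1) * q < n + 1"
    and big: "m * ((k - 1) * n + m) < (n + 1) * (q + 1)"
  shows "arrows (k * n + m + 2) k (double_star n m)"
  unfolding arrows_def
proof (intro allI impI, rule ccontr)
  fix \<tau>
  define N where "N = k * n + m + 2"
  assume "edge_coloring k (complete_graph (k * n + m + 2)) \<tau>"
    and no: "\<not> has_monochromatic_copy k (complete_graph (k * n + m + 2)) \<tau> (double_star n m)"
  then have col: "\<tau> {x, y} \<in> {1..k}" if "x < N" "y < N" "x \<noteq> y" for x y
    using that by (auto simp: edge_coloring_def complete_graph_def N_def)
  have kn: "k * n = (k - 1) * n + n"
    using k by (cases k) auto

  \<comment> \<open>Leaf sets that are too large can be shrunk, so only lower bounds on their sizes are asked.\<close>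
  have free: False if "i \<in> {1..k}" "a < N" "b < N" "a \<noteq> b" "\<tau> {a, b} = i"
      "A' \<subseteq> {..<N}" "B' \<subseteq> {..<N}" "\<forall>x\<in>A'. \<tau> {a, x} = i" "\<forall>x\<in>B'. \<tau> {b, x} = i"
      "n \<le> card A'" "m \<le> card B'" "A' \<inter> B' = {}" "a \<notin> A' \<union> B'" "b \<notin> A' \<union> B'" for i a b A' B'
  proof -
    obtain A where A: "A \<subseteq> A'" "card A = n" "finite A"
      using obtain_subset_with_card_n[OF \<open>n \<le> card A'\<close>] by blast
    obtain B where B: "B \<subseteq> B'" "card B = m" "finite B"
      using obtain_subset_with_card_n[OF \<open>m \<le> card B'\<close>] by blast
    have A0: "x < N \<and> x \<noteq> a \<and> \<tau> {a, x} = i" if "x \<in> A" for x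
      using that A(1) \<open>A' \<subseteq> {..<N}\<close> \<open>a \<notin> A' \<union> B'\<close> \<open>\<forall>x\<in>A'. \<tau> {a, x} = i\<close> by blast
    have B0: "x < N \<and> x \<noteq> b \<and> \<tau> {b, x} = i" if "x \<in> B" for x
      using that B(1) \<open>B' \<subseteq> {..<N}\<close> \<open>b \<notin> A' \<union> B'\<close> \<open>\<forall>x\<in>B'. \<tau> {b, x} = i\<close> by blast
    have "double_star_at (edges (color_class (complete_graph N) \<tau> i)) n m a b A B"
      unfolding double_star_at_def edge_color_class_complete_graph
      using that(2-5,12-14) A B A0 B0 by blast
    then have "contains_copy (color_class (complete_graph N) \<tau> i) (double_star n m)"
      by (rule double_star_at_imp_contains_copy[OF is_graph_color_class[OF is_graph_complete_graph]])
    then show False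
      using no \<open>i \<in> {1..k}\<close> by (auto simp: has_monochromatic_copy_def N_def)
  qed

  \<comment> \<open>Every vertex has degree \<open>k n + m + 1 > k n\<close>; vertex \<open>0\<close> is as good as any.\<close>
  have N0: "0 < N" by (simp add: N_def)
  obtain i where i: "i \<in> {1..k}" "n < card {w \<in> {..<N} - {0}. \<tau> {0, w} = i}"
  proof (rule pigeonhole_card_fibre[of "{1..k}" "\<lambda>w. \<tau> {0, w}" "{..<N} - {0}" n])
    show "(\<lambda>w. \<tau> {0, w}) ` ({..<N} - {0}) \<subseteq> {1..k}"
      using col[of 0] N0 by blast
    show "card {1..k} * n < card ({..<N} - {0})"
      by (simp add: N_def)
  qed auto
  then obtain S where S: "S \<subseteq> {w \<in> {..<N} - {0}. \<tau> {0, w} = i}" "card S = n + 1" "finite S"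
    using obtain_subset_with_card_n[of "n + 1"] by (metis Suc_eq_plus1 Suc_leI)
  have SN: "S \<subseteq> {..<N}" "0 \<notin> S" and Si: "\<And>u. u \<in> S \<Longrightarrow> \<tau> {0, u} = i"
    using S(1) by auto
  define W where "W = {..<N} - insert 0 S"
  have "card W = N - (n + 2)"
    unfolding W_def using S SN N0 by (subst card_Diff_subset) auto
  then have cW: "card W = (k - 1) * n + m"
    by (simp add: N_def kn)
  have finW: "finite W" and WN: "W \<subseteq> {..<N}" "0 \<notin> W" "W \<inter> S = {}"
    by (auto simp: W_def)

  have "\<exists>j \<in> {1..k} - {i}. n < card {w \<in> W. \<tau> {u, w} = j}" if u: "u \<in> S" for u
  proof -
    have uN: "u < N" "u \<noteq> 0" "u \<notin> W"
      using u SN WN by auto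
    \<comment> \<open>Otherwise \<open>0\<close> and \<open>u\<close> are the centres of \<open>S(n,m)\<close>, with leaves in \<open>S\<close> and in \<open>W\<close>.\<close>
    have few: "card {w \<in> W. \<tau> {u, w} = i} < m"
    proof (rule ccontr)
      assume "\<not> ?thesis"
      then have "m \<le> card {w \<in> W. \<tau> {u, w} = i}"
        by simp
      moreover have "n \<le> card (S - {u})"
        using S u by simp
      moreover have "S - {u} \<subseteq> {..<N}" "{w \<in> W. \<tau> {u, w} = i} \<subseteq> {..<N}"
        "(S - {u}) \<inter> {w \<in> W. \<tau> {u, w} = i} = {}"
        "0 \<notin> (S - {u}) \<union> {w \<in> W. \<tau> {u, w} = i}"
        "u \<notin> (S - {u}) \<union> {w \<in> W. \<tau> {u, w} = i}"
        using SN WN uN by blast+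
      moreover have "\<forall>x\<in>S - {u}. \<tau> {0, x} = i" "\<tau> {0, u} = i"
        using Si u by auto
      moreover have "\<forall>x\<in>{w \<in> W. \<tau> {u, w} = i}. \<tau> {u, x} = i"
        by blast
      ultimately show False
        using free[of i 0 u "S - {u}" "{w \<in> W. \<tau> {u, w} = i}", OF i(1) N0 uN(1)] uN(2) by metis
    qed
    have "card W = card {w \<in> W. \<tau> {u, w} = i} + card {w \<in> W. \<tau> {u, w} \<noteq> i}"
      using finW by (subst card_Un_disjoint[symmetric]) (auto intro!: arg_cong[where f = card])
    then have many: "(k - 1) * n < card {w \<in> W. \<tau> {u, w} \<noteq> i}"
      using few cW by linarith
    obtain j where "j \<in> {1..k} - {i}" "n < card {w \<in> {w \<in> W. \<tau> {u, w} \<noteq> i}. \<tau> {u, w} = j}"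
    proof (rule pigeonhole_card_fibre[of "{1..k} - {i}" "\<lambda>w. \<tau> {u, w}" "{w \<in> W. \<tau> {u, w} \<noteq> i}" n])
      have "\<tau> {u, w} \<in> {1..k}" if "w \<in> W" for w
        using col[of u w] that uN WN by auto
      then show "(\<lambda>w. \<tau> {u, w}) ` {w \<in> W. \<tau> {u, w} \<noteq> i} \<subseteq> {1..k} - {i}"
        by blast
      show "card ({1..k} - {i}) * n < card {w \<in> W. \<tau> {u, w} \<noteq> i}"
        using i(1) many by simp
    qed auto
    moreover have "card {w \<in> {w \<in> W. \<tau> {u, w} \<noteq> i}. \<tau> {u, w} = j} \<le> card {w \<in> W. \<tau> {u, w} = j}" for j
      using finW by (intro card_mono) auto
    ultimately show ?thesis
      by (meson less_le_trans)
  qed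
  then have "\<forall>u\<in>S. \<exists>j. j \<in> {1..k} - {i} \<and> n < card {w \<in> W. \<tau> {u, w} = j}"
    by blast
  then obtain c where "\<forall>u\<in>S. c u \<in> {1..k} - {i} \<and> n < card {w \<in> W. \<tau> {u, w} = c u}"
    by (rule bchoice[THEN exE])
  then have c: "c u \<in> {1..k} - {i}" "n < card {w \<in> W. \<tau> {u, w} = c u}" if "u \<in> S" for u
    using that by blast+

  obtain j where j: "j \<in> {1..k} - {i}" "q < card {u \<in> S. c u = j}"
  proof (rule pigeonhole_card_fibre[of "{1..k} - {i}" c S q])
    show "c ` S \<subseteq> {1..k} - {i}"
      using c(1) by blast
    show "card ({1..k} - {i}) * q < card S"
      using i(1) q S(2) by simp
  qed auto
  define U where "U = {u \<in> S. c u = j}"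
  have finU: "finite U" and US: "U \<subseteq> S" and Uj: "\<And>u. u \<in> U \<Longrightarrow> n < card {w \<in> W. \<tau> {u, w} = j}"
    using S(3) c(2) by (auto simp: U_def)

  \<comment> \<open>Double counting of the edges of colour \<open>j\<close> between \<open>U\<close> and \<open>W\<close>.\<close>
  have "\<exists>w\<in>W. m < card {u \<in> U. \<tau> {u, w} = j}"
  proof (rule ccontr)
    assume *: "\<not> ?thesis"
    have "(n + 1) * (q + 1) \<le> (n + 1) * card U"
      using j(2) by (intro mult_le_mono2) (simp add: U_def)
    also have "\<dots> \<le> (\<Sum>u\<in>U. card {w \<in> W. \<tau> {u, w} = j})"
      using Uj sum_bounded_below[of U "n + 1" "\<lambda>u. card {w \<in> W. \<tau> {u, w} = j}"]
      by (simp add: Suc_le_eq mult.commute)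
    also have "\<dots> = (\<Sum>w\<in>W. card {u \<in> U. \<tau> {u, w} = j})"
      using finU finW by (intro sum_multicount_gen) auto
    also have "\<dots> \<le> m * card W"
      using * sum_bounded_above[of W "\<lambda>w. card {u \<in> U. \<tau> {u, w} = j}" m]
      by (simp add: not_less mult.commute)
    finally show False
      using big cW by simp
  qed
  then obtain w where w: "w \<in> W" "m < card {u \<in> U. \<tau> {u, w} = j}"
    by blast
  then obtain u where u: "u \<in> U" "\<tau> {u, w} = j"
    by (metis (mono_tags, lifting) card.empty empty_Collect_eq not_less_zero)
  define P where "P = {x \<in> W. \<tau> {u, x} = j} - {w}"
  define Q where "Q = {x \<in> U. \<tau> {x, w} = j} - {u}"
  have "w \<in> {x \<in> W. \<tau> {u, x} = j}" "u \<in> {x \<in> U. \<tau> {x, w} = j}"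
    using w u by auto
  then have card: "n \<le> card P" "m \<le> card Q"
    using Uj[OF u(1)] w(2) by (simp_all add: P_def Q_def)
  have PW: "P \<subseteq> W - {w}" and QU: "Q \<subseteq> U - {u}"
    by (auto simp: P_def Q_def)
  have uS: "u \<in> S"
    using u(1) US by blast
  have "u < N" "w < N" "u \<noteq> w" "P \<subseteq> {..<N}" "Q \<subseteq> {..<N}"
    "P \<inter> Q = {}" "u \<notin> P \<union> Q" "w \<notin> P \<union> Q"
    using uS w(1) PW QU US SN WN by blast+
  moreover have "\<forall>x\<in>P. \<tau> {u, x} = j"
    by (simp add: P_def)
  moreover have "\<forall>x\<in>Q. \<tau> {w, x} = j"
    by (auto simp: Q_def insert_commute)
  moreover have "j \<in> {1..k}"
    using j(1) by blast
  ultimately show False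
    using free[of j u w P Q] u(2) card by blast
qed

section \<open>Colourings without a monochromatic double star\<close>

text \<open>
  The centre of degree at least \<open>n + 1\<close> must lie in \<open>X\<close>. A double star is connected, so all its
  \<open>n + m + 2\<close> vertices lie in \<open>X\<close>, which is too small.
\<close>

lemma no_double_star_if_small_closed_set:
  assumes G: "is_graph G" and X: "finite X" "card X \<le> n + m + 1"
    and closed: "\<And>x y. x \<in> X \<Longrightarrow> {x, y} \<in> edges G \<Longrightarrow> y \<in> X"
    and deg: "\<And>x. x \<in> verts G \<Longrightarrow> x \<notin> X \<Longrightarrow> card {y. {x, y} \<in> edges G} \<le> n"
  shows "\<not> contains_copy G (double_star n m)"
proof
  assume "contains_copy G (double_star n m)"
  then obtain u v A B where "double_star_at (edges G) n m u v A B"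
    by (rule contains_copy_imp_double_star_at)
  note D = this[unfolded double_star_at_def]
  have uv: "u \<in> verts G" "u \<noteq> v"
    using D is_graph_edgeD[OF G, of u v] by auto
  have fin: "finite {y. {u, y} \<in> edges G}"
    using is_graph_edgeD(2)[OF G, of u] G
    by (auto simp: is_graph_def intro: finite_subset[of _ "verts G"])
  have "card (insert v A) \<le> card {y. {u, y} \<in> edges G}"
    using D by (intro card_mono fin) auto
  moreover have "card (insert v A) = n + 1"
    using D by simp
  ultimately have "u \<in> X"
    using deg[OF uv(1)] by fastforce
  then have "insert u (insert v (A \<union> B)) \<subseteq> X"
    using closed D by blast
  then have "card (insert u (insert v (A \<union> B))) \<le> n + m + 1"
    using X by (meson card_mono order_trans)
  moreover have "card (insert u (insert v (A \<union> B))) = n + m + 2"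
    using D uv by (simp add: card_Un_disjoint)
  ultimately show False by simp
qed

lemma card_same_residue_le:
  assumes "T \<subseteq> {..<k * n}" and "\<And>x y. x \<in> T \<Longrightarrow> y \<in> T \<Longrightarrow> [x = y] (mod k)"
  shows "card T \<le> (n::nat)"
proof -
  have "inj_on (\<lambda>x. x div k) T"
    using assms(2) by (intro inj_onI) (metis cong_def div_mult_mod_eq)
  moreover have "(\<lambda>x. x div k) ` T \<subseteq> {..<n}"
    using assms(1) by (auto simp: less_mult_imp_div_less mult.commute)
  ultimately show ?thesis
    using card_inj_on_le[of "\<lambda>x. x div k" T "{..<n}"] by simp
qed

lemma not_arrows_if_residue_coloring:
  assumes k: "k \<ge> 1" and g: "\<And>e. g e = 1 + s e mod k"
    and no: "\<And>c. c < k \<Longrightarrow> \<not> contains_copy (color_class (complete_graph N) g (1 + c)) H"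
  shows "\<not> arrows N k H"
proof
  assume "arrows N k H"
  moreover have "edge_coloring k (complete_graph N) g"
    using k by (auto simp: edge_coloring_def g Suc_le_eq)
  ultimately obtain c where "c \<in> {1..k}" "contains_copy (color_class (complete_graph N) g c) H"
    by (auto simp: arrows_def has_monochromatic_copy_def)
  moreover from this have "c - 1 < k" "1 + (c - 1) = c"
    by auto
  ultimately show False
    using no[of "c - 1"] by simp
qed

lemma not_arrows_mult:
  assumes k: "k \<ge> 1"
  shows "\<not> arrows (k * n) k (double_star n m)"
proof (rule not_arrows_if_residue_coloring[OF k refl])
  fix c
  define G where "G = color_class (complete_graph (k * n)) (\<lambda>e. 1 + \<Sum>e mod k) (1 + c)"
  have edge: "{x, y} \<in> edges G \<longleftrightarrow> x < k * n \<and> y < k * n \<and> x \<noteq> y \<and> (x + y) mod k = c" for x y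
    unfolding G_def edge_color_class_complete_graph by auto
  have "\<not> contains_copy G (double_star n m)"
  proof (rule no_double_star_if_small_closed_set[where X = "{}"])
    show "is_graph G"
      unfolding G_def by (intro is_graph_color_class is_graph_complete_graph)
    fix x
    show "card {y. {x, y} \<in> edges G} \<le> n"
    proof (rule card_same_residue_le)
      fix y z assume "y \<in> {y. {x, y} \<in> edges G}" "z \<in> {y. {x, y} \<in> edges G}"
      then have "[x + y = x + z] (mod k)"
        by (simp add: edge cong_def)
      then show "[y = z] (mod k)"
        by (simp add: cong_add_lcancel_nat)
    qed (auto simp: edge)
  qed auto
  then show "\<not> contains_copy (color_class (complete_graph (k * n)) (\<lambda>e. 1 + \<Sum>e mod k) (1 + c))
      (double_star n m)"
    by (simp add: G_def)
qed

text \<open>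
  The vertices below \<open>k n\<close> form the classes \<open>Q\<^sub>r\<close> of equal residue modulo \<open>k\<close>; the remaining \<open>m + 1\<close>
  vertices form \<open>P\<close>. In an edge from \<open>Q\<^sub>r\<close> to \<open>P\<close> the smaller vertex is the one in \<open>Q\<^sub>r\<close>.
\<close>

lemma not_arrows_odd:
  assumes k: "odd k"
  shows "\<not> arrows (k * n + m + 1) k (double_star n m)"
proof (rule not_arrows_if_residue_coloring)
  define s where "s e = Min e + (if Max e < k * n then Max e else Min e)" for e :: "nat set"
  define g where "g e = 1 + s e mod k" for e
  show "k \<ge> 1" using k by (cases k) auto
  show "g e = 1 + s e mod k" for e by (simp add: g_def)
  fix c assume c: "c < k"
  define N where "N = k * n + m + 1"
  define G where "G = color_class (complete_graph N) g (1 + c)"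
  define X where "X = {a. a < k * n \<and> [2 * a = c] (mod k)} \<union> {k * n..<N}"
  have edge: "{x, y} \<in> edges G \<longleftrightarrow> x < N \<and> y < N \<and> x \<noteq> y \<and> [s {x, y} = c] (mod k)" for x y
    unfolding G_def edge_color_class_complete_graph g_def using c by (auto simp: cong_def)
  have s1: "s {x, y} = x + y" if "x < k * n" "y < k * n" for x y
    using that by (auto simp: s_def min_def max_def)
  have s2: "s {x, y} = 2 * x" "s {y, x} = 2 * x" if "x < k * n" "\<not> y < k * n" for x y
    using that by (auto simp: s_def min_def max_def)
  have "\<not> contains_copy G (double_star n m)"
  proof (rule no_double_star_if_small_closed_set[where X = X])
    show "is_graph G"
      unfolding G_def by (intro is_graph_color_class is_graph_complete_graph)
    show "finite X"
      by (simp add: X_def)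
    \<comment> \<open>Halving modulo \<open>k\<close> is where \<open>k\<close> must be odd: \<open>X\<close> meets only one residue class below \<open>k n\<close>.\<close>
    have "card {a. a < k * n \<and> [2 * a = c] (mod k)} \<le> n"
    proof (rule card_same_residue_le)
      fix x y
      assume "x \<in> {a. a < k * n \<and> [2 * a = c] (mod k)}" "y \<in> {a. a < k * n \<and> [2 * a = c] (mod k)}"
      then have "[2 * x = 2 * y] (mod k)"
        by (auto simp: cong_def)
      moreover have "coprime 2 k"
        using k by simp
      ultimately show "[x = y] (mod k)"
        by (simp add: cong_mult_lcancel_nat)
    qed auto
    then show "card X \<le> n + m + 1"
      unfolding X_def by (intro order_trans[OF card_Un_le]) (simp add: N_def)
  next
    fix x y assume x: "x \<in> X" and e: "{x, y} \<in> edges G"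
    show "y \<in> X"
    proof (cases "y < k * n")
      case y: True
      show ?thesis
      proof (cases "x < k * n")
        case True
        then have "[x + y = c] (mod k)" "[2 * x = c] (mod k)"
          using e x y by (auto simp: edge s1 X_def)
        then have "[x + y = x + x] (mod k)"
          by (simp add: cong_def mult_2)
        then have "[y = x] (mod k)"
          by (simp add: cong_add_lcancel_nat)
        then have "[2 * y = 2 * x] (mod k)"
          by (rule cong_scalar_left)
        then have "[2 * y = c] (mod k)"
          using \<open>[2 * x = c] (mod k)\<close> by (rule cong_trans)
        then show ?thesis
          using y by (simp add: X_def)
      next
        case False
        then show ?thesis
          using e y by (simp add: edge s2 X_def)
      qed
    next
      case False
      then show ?thesis
        using e by (simp add: edge X_def)
    qed
  next
    fix x assume "x \<in> verts G" "x \<notin> X"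
    then have x: "x < k * n" "\<not> [2 * x = c] (mod k)"
      by (auto simp: X_def G_def color_class_def complete_graph_def)
    then have nb: "y < k * n \<and> [x + y = c] (mod k)" if "{x, y} \<in> edges G" for y
      using that s1[of x y] s2[of x y] by (cases "y < k * n") (auto simp: edge)
    show "card {y. {x, y} \<in> edges G} \<le> n"
    proof (rule card_same_residue_le)
      fix y z assume "y \<in> {y. {x, y} \<in> edges G}" "z \<in> {y. {x, y} \<in> edges G}"
      then have "[x + y = x + z] (mod k)"
        using nb by (auto simp: cong_def)
      then show "[y = z] (mod k)"
        by (simp add: cong_add_lcancel_nat)
    qed (use nb in auto)
  qed
  then show "\<not> contains_copy (color_class (complete_graph (k * n + m + 1)) g (1 + c))
      (double_star n m)"
    by (simp add: G_def N_def)
qed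

text \<open>
  The new colour forms a complete bipartite graph in which the old vertices have degree \<open>m\<close>, too
  small for a centre. Edges between new vertices can reuse colour \<open>1\<close>: there they form components
  with only \<open>m\<close> vertices.
\<close>

lemma not_arrows_join:
  assumes k: "k \<ge> 1" and nm: "m \<le> n" and N: "\<not> arrows N k (double_star n m)"
  shows "\<not> arrows (N + m) (k + 1) (double_star n m)"
proof
  assume arr: "arrows (N + m) (k + 1) (double_star n m)"
  obtain \<tau> where \<tau>: "edge_coloring k (complete_graph N) \<tau>"
    and no: "\<And>c. c \<in> {1..k} \<Longrightarrow> \<not> contains_copy (color_class (complete_graph N) \<tau> c) (double_star n m)"
    using N by (auto simp: arrows_def has_monochromatic_copy_def)
  have \<tau>k: "\<tau> {x, y} \<in> {1..k}" if "x < N" "y < N" "x \<noteq> y" for x y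
    using \<tau> that by (auto simp: edge_coloring_def complete_graph_def)
  define \<sigma> where "\<sigma> e = (if e \<subseteq> {..<N} then \<tau> e else if e \<inter> {..<N} = {} then 1 else k + 1)" for e
  have "edge_coloring (k + 1) (complete_graph (N + m)) \<sigma>"
    unfolding edge_coloring_def
  proof (rule Pi_I)
    fix e assume "e \<in> edges (complete_graph (N + m))"
    then have "e \<subseteq> {..<N} \<Longrightarrow> e \<in> edges (complete_graph N)"
      by (simp add: complete_graph_def nsets_def)
    then have "e \<subseteq> {..<N} \<Longrightarrow> \<tau> e \<in> {1..k}"
      using \<tau> by (auto simp: edge_coloring_def)
    then show "\<sigma> e \<in> {1..k + 1}"
      by (auto simp: \<sigma>_def)
  qed
  then obtain c where c: "c \<in> {1..k + 1}"
    "contains_copy (color_class (complete_graph (N + m)) \<sigma> c) (double_star n m)"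
    using arr by (auto simp: arrows_def has_monochromatic_copy_def)
  from c(2) obtain u v A B
    where "double_star_at (edges (color_class (complete_graph (N + m)) \<sigma> c)) n m u v A B"
    by (rule contains_copy_imp_double_star_at)
  note D = this[unfolded double_star_at_def edge_color_class_complete_graph]
  have \<sigma>old: "\<sigma> {x, y} = \<tau> {x, y}" if "x < N" "y < N" for x y
    using that by (simp add: \<sigma>_def)
  have \<sigma>mix: "\<sigma> {x, y} = k + 1" if "(x < N) \<noteq> (y < N)" for x y
    using that by (auto simp: \<sigma>_def)
  have \<sigma>new: "\<sigma> {x, y} = 1" if "\<not> x < N" "\<not> y < N" for x y
    using that by (auto simp: \<sigma>_def)
  show False
  proof (cases "c = k + 1")
    case True
    have mix: "(x < N) \<noteq> (y < N)" if "\<sigma> {x, y} = c" "x \<noteq> y" for x y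
      using that \<sigma>old[of x y] \<tau>k[of x y] \<sigma>new[of x y] True k by fastforce
    have small: False if "x < N" "finite T" "m < card T"
        "\<forall>y\<in>T. y < N + m \<and> x \<noteq> y \<and> \<sigma> {x, y} = c" for x T
    proof -
      have "T \<subseteq> {N..<N + m}"
        using that mix[of x] by fastforce
      then have "card T \<le> m"
        using card_mono[of "{N..<N + m}" T] by simp
      then show False
        using that(3) by simp
    qed
    have vu: "\<sigma> {v, u} = \<sigma> {u, v}"
      by (simp add: insert_commute)
    have "u < N \<or> v < N"
      using mix[of u v] D by auto
    then show False
    proof
      assume "u < N"
      then show False
        using small[of u "insert v A"] D nm by auto
    next
      assume "v < N"
      then show False
        using small[of v "insert u B"] D vu by auto
    qed
  next
    case False
    then have same: "(x < N) = (y < N)" if "\<sigma> {x, y} = c" for x y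
      using that \<sigma>mix[of x y] by auto
    have "(v < N) = (u < N)" "\<And>a. a \<in> A \<Longrightarrow> (a < N) = (u < N)" "\<And>b. b \<in> B \<Longrightarrow> (b < N) = (v < N)"
      using same[of u] same[of v] D by blast+
    then have all: "\<forall>x \<in> insert u (insert v (A \<union> B)). (x < N) = (u < N)"
      by blast
    show False
    proof (cases "u < N")
      case True
      then have lt: "v < N" "\<And>x. x \<in> A \<Longrightarrow> x < N" "\<And>x. x \<in> B \<Longrightarrow> x < N"
        using all by blast+
      have old: "y < N \<Longrightarrow> \<sigma> {u, y} = \<tau> {u, y}" "y < N \<Longrightarrow> \<sigma> {v, y} = \<tau> {v, y}" for y
        using \<sigma>old True lt(1) by blast+
      have Dc: "u \<noteq> v" "\<sigma> {u, v} = c" "\<forall>a\<in>A. u \<noteq> a \<and> \<sigma> {u, a} = c"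
        "\<forall>b\<in>B. v \<noteq> b \<and> \<sigma> {v, b} = c"
        using D by blast+
      have "u \<noteq> v \<and> \<tau> {u, v} = c" "\<forall>a\<in>A. u \<noteq> a \<and> \<tau> {u, a} = c" "\<forall>b\<in>B. v \<noteq> b \<and> \<tau> {v, b} = c"
        using Dc old(1)[OF lt(1)] old(1)[OF lt(2)] old(2)[OF lt(3)] by simp_all
      then have "double_star_at (edges (color_class (complete_graph N) \<tau> c)) n m u v A B"
        unfolding double_star_at_def edge_color_class_complete_graph
        using D True lt by blast
      then have "contains_copy (color_class (complete_graph N) \<tau> c) (double_star n m)"
        by (rule double_star_at_imp_contains_copy[OF is_graph_color_class[OF is_graph_complete_graph]])
      then show False
        using no[of c] c(1) False by auto
    next
      case new: False
      have "insert v B \<subseteq> {N..<N + m}"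
        using D all new by (auto simp: subset_iff not_less)
      then have "card (insert v B) \<le> m"
        using card_mono[of "{N..<N + m}" "insert v B"] by simp
      then show False
        using D by simp
    qed
  qed
qed

section \<open>The Ramsey numbers of double stars\<close>

theorem theorem1p6:
  fixes k n m :: nat
  assumes "k \<ge> 1" and "n \<ge> m" and "m \<ge> 1"
    and "k = 1 \<or>
         (k \<ge> 2 \<and>
          int (n + 1) * \<lceil>real (n + 1) / real (k - 1)\<rceil> > int (m * ((k - 1) * n + m)))"
  shows "(odd k \<longrightarrow> ramsey_number (double_star n m) k = k * n + m + 2) \<and>
         (even k \<longrightarrow>
           max (k * n + 1) ((k - 1) * n + 2 * m + 2) \<le> ramsey_number (double_star n m) k \<and>
           ramsey_number (double_star n m) k \<le> k * n + m + 2)"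
proof -
  have "\<exists>q. (k - 1) * q < n + 1 \<and> m * ((k - 1) * n + m) < (n + 1) * (q + 1)"
  proof (cases "k = 1")
    case True
    have "m * m < (n + 1) * (m * m + 1)"
      by simp
    then show ?thesis
      using True by (intro exI[of _ "m * m"]) simp
  next
    case False
    define z where "z = \<lceil>real (n + 1) / real (k - 1)\<rceil>"
    have k1: "0 < real (k - 1)" and hyp: "int (m * ((k - 1) * n + m)) < int (n + 1) * z"
      using False assms(1,4) by (auto simp: z_def)
    have "0 < z"
      using k1 by (simp add: z_def)
    then obtain q where q: "z = int q + 1"
      by (metis add.commute zless_iff_Suc_zadd add_0 of_nat_Suc)
    have "real q < real (n + 1) / real (k - 1)"
      using q ceiling_correct[of "real (n + 1) / real (k - 1)"] by (simp add: z_def)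
    then have "real ((k - 1) * q) < real (n + 1)"
      using k1 by (simp add: pos_less_divide_eq mult.commute)
    then have "(k - 1) * q < n + 1"
      by (simp only: of_nat_less_iff)
    moreover have "int (m * ((k - 1) * n + m)) < int ((n + 1) * (q + 1))"
      using hyp q by (simp add: algebra_simps)
    ultimately show ?thesis
      by (metis of_nat_less_iff)
  qed
  then have upper: "arrows (k * n + m + 2) k (double_star n m)"
    using arrows_double_star[OF assms(1)] by blast
  note gt = ramsey_number_gt[OF upper]
  have "k * n + m + 1 < ramsey_number (double_star n m) k" if "odd k"
    using gt not_arrows_odd[OF that] by blast
  moreover have "(k - 1) * n + 2 * m + 1 < ramsey_number (double_star n m) k" if "even k"
  proof (rule gt)
    have odd: "odd (k - 1)" and "1 \<le> k - 1" and k: "k - 1 + 1 = k"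
      using that assms(1) by (auto elim: evenE)
    then have "\<not> arrows ((k - 1) * n + m + 1 + m) (k - 1 + 1) (double_star n m)"
      using not_arrows_join[OF _ assms(2) not_arrows_odd] by blast
    moreover have "(k - 1) * n + m + 1 + m = (k - 1) * n + 2 * m + 1"
      by simp
    ultimately show "\<not> arrows ((k - 1) * n + 2 * m + 1) k (double_star n m)"
      unfolding k by metis
  qed
  moreover have "k * n < ramsey_number (double_star n m) k"
    using gt not_arrows_mult[OF assms(1)] by blast
  ultimately show ?thesis
    using ramsey_number_le[OF upper] by auto
qed

end
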